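(* Let $\mathbb T$ be a time scale and $a,b\in\mathbb T$ with $a<b$. If $f,g:\mathbb T\to\mathbb R$ are $\diamondsuit$-integrable on $[a,b]_{\mathbb T}$ and $p>1$, then $$\left(\int_a^b|f(t)+g(t)|^p\,\diamondsuit t\right)^{\frac1p}\le\left(\int_a^b|f(t)|^p\,\diamondsuit t\right)^{\frac1p}+\left(\int_a^b|g(t)|^p\,\diamondsuit t\right)^{\frac1p}.$$
   Context: A time scale $\mathbb T$ is a nonempty closed subset of $\mathbb R$. $\sigma(t)=\inf\{s\in\mathbb T:s>t\}$, $\rho(t)=\sup\{s\in\mathbb T:s<t\}$, with $\inf\emptyset=\sup\mathbb T$, $\sup\emptyset=\inf\mathbb T$. $[a,b]_{\mathbb T}=\{t\in\mathbb T:a\le t\le b\}$, and half-open intervals similarly. Define $\gamma_1,\gamma_2:\mathbb T\to\mathbb R$ by $$\gamma_1(t)=\lim_{s\to t}\frac{\sigma(t)-s}{\sigma(t)+2t-2s-\rho(t)},\qquad\gamma_2(t)=\lim_{s\to t}\frac{(2t-s)-\rho(t)}{\sigma(t)+2t-2s-\rho(t)}$$ (limits over the real variable $s\ne t$). The diamond integral of $f$ from $a$ to $b$ is $$\int_a^bf(t)\,\diamondsuit t=\int_a^b\gamma_1(t)f(t)\,\Delta t+\int_a^b\gamma_2(t)f(t)\,\nabla t,$$ provided $\gamma_1f$ is delta integrable and $\gamma_2f$ is nabla integrable on $[a,b]_{\mathbb T}$; then $f$ is called $\diamondsuit$-integrable on $[a,b]_{\mathbb T}$. Delta and nabla integrals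 are the standard (Riemann) time scale integrals: the delta (resp. nabla) integral is the limit as $\delta\to0^+$ of sums $\sum_if(\xi_i)(t_i-t_{i-1})$ with $\xi_i\in[t_{i-1},t_i)_{\mathbb T}$ (resp. $\xi_i\in(t_{i-1},t_i]_{\mathbb T}$) over partitions $a=t_0<\dots<t_n=b$ in $\mathbb T$ such that for each $i$ either $t_i-t_{i-1}\le\delta$, or $t_i-t_{i-1}>\delta$ and $\rho(t_i)=t_{i-1}$. If $f$ is integrable and $F^\Delta=f$ (resp. $F^\nabla=f$), the integral equals $F(b)-F(a)$. *)

theory Defs
  imports Complex_Main
begin

definition time_scale :: "real set \<Rightarrow> bool" where
  "time_scale T \<longleftrightarrow> T \<noteq> {} \<and> closed T"

(* If no point of T lies above (below) t, the convention Inf {} = Sup T (Sup {} = Inf T)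
   is applied; for t in T this occurs only when t is the maximum (minimum) of T. *)

definition fwd_jump :: "real set \<Rightarrow> real \<Rightarrow> real" where
  "fwd_jump T t = (if {s \<in> T. s > t} = {} then Sup T else Inf {s \<in> T. s > t})"

definition bwd_jump :: "real set \<Rightarrow> real \<Rightarrow> real" where
  "bwd_jump T t = (if {s \<in> T. s < t} = {} then Inf T else Sup {s \<in> T. s < t})"

(* The limits run over real s with s \<noteq> t, not only over s in T. *)

definition gamma1 :: "real set \<Rightarrow> real \<Rightarrow> real" where
  "gamma1 T t = Lim (at t)
     (\<lambda>s. (fwd_jump T t - s) / (fwd_jump T t + 2 * t - 2 * s - bwd_jump T t))"

definition gamma2 :: "real set \<Rightarrow> real \<Rightarrow> real" where
  "gamma2 T t = Lim (at t)
     (\<lambda>s. ((2 * t - s) - bwd_jump T t) / (fwd_jump T t + 2 * t - 2 * s - bwd_jump T t))"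

(* A partition a = t 0 < ... < t n = b in T; a subinterval longer than \<delta> is allowed
   only when it is a gap of T. *)

definition fine_partition ::
  "real set \<Rightarrow> real \<Rightarrow> real \<Rightarrow> real \<Rightarrow> nat \<Rightarrow> (nat \<Rightarrow> real) \<Rightarrow> bool" where
  "fine_partition T a b \<delta> n t \<longleftrightarrow>
     t 0 = a \<and> t n = b \<and> (\<forall>i\<le>n. t i \<in> T) \<and> (\<forall>i<n. t i < t (Suc i)) \<and>
     (\<forall>i<n. t (Suc i) - t i \<le> \<delta> \<or>
            (t (Suc i) - t i > \<delta> \<and> bwd_jump T (t (Suc i)) = t i))"

definition has_delta_integral ::
  "real set \<Rightarrow> (real \<Rightarrow> real) \<Rightarrow> real \<Rightarrow> real \<Rightarrow> real \<Rightarrow> bool" where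
  "has_delta_integral T f a b I \<longleftrightarrow>
     (\<forall>\<epsilon>>0. \<exists>\<delta>>0. \<forall>n t \<xi>.
        fine_partition T a b \<delta> n t \<and> (\<forall>i<n. \<xi> i \<in> {t i..<t (Suc i)} \<inter> T) \<longrightarrow>
        \<bar>(\<Sum>i<n. f (\<xi> i) * (t (Suc i) - t i)) - I\<bar> < \<epsilon>)"

definition has_nabla_integral ::
  "real set \<Rightarrow> (real \<Rightarrow> real) \<Rightarrow> real \<Rightarrow> real \<Rightarrow> real \<Rightarrow> bool" where
  "has_nabla_integral T f a b I \<longleftrightarrow>
     (\<forall>\<epsilon>>0. \<exists>\<delta>>0. \<forall>n t \<xi>.
        fine_partition T a b \<delta> n t \<and> (\<forall>i<n. \<xi> i \<in> {t i<..t (Suc i)} \<inter> T) \<longrightarrow>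
        \<bar>(\<Sum>i<n. f (\<xi> i) * (t (Suc i) - t i)) - I\<bar> < \<epsilon>)"

definition delta_integrable :: "real set \<Rightarrow> (real \<Rightarrow> real) \<Rightarrow> real \<Rightarrow> real \<Rightarrow> bool" where
  "delta_integrable T f a b \<longleftrightarrow> (\<exists>I. has_delta_integral T f a b I)"

definition nabla_integrable :: "real set \<Rightarrow> (real \<Rightarrow> real) \<Rightarrow> real \<Rightarrow> real \<Rightarrow> bool" where
  "nabla_integrable T f a b \<longleftrightarrow> (\<exists>I. has_nabla_integral T f a b I)"

definition delta_integral :: "real set \<Rightarrow> (real \<Rightarrow> real) \<Rightarrow> real \<Rightarrow> real \<Rightarrow> real" where
  "delta_integral T f a b = (THE I. has_delta_integral T f a b I)"

definition nabla_integral :: "real set \<Rightarrow> (real \<Rightarrow> real) \<Rightarrow> real \<Rightarrow> real \<Rightarrow> real" where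
  "nabla_integral T f a b = (THE I. has_nabla_integral T f a b I)"

definition diamond_integrable :: "real set \<Rightarrow> (real \<Rightarrow> real) \<Rightarrow> real \<Rightarrow> real \<Rightarrow> bool" where
  "diamond_integrable T f a b \<longleftrightarrow>
     delta_integrable T (\<lambda>t. gamma1 T t * f t) a b \<and>
     nabla_integrable T (\<lambda>t. gamma2 T t * f t) a b"

(* Meaningful only when diamond_integrable T f a b holds. *)

definition diamond_integral :: "real set \<Rightarrow> (real \<Rightarrow> real) \<Rightarrow> real \<Rightarrow> real \<Rightarrow> real" where
  "diamond_integral T f a b =
     delta_integral T (\<lambda>t. gamma1 T t * f t) a b +
     nabla_integral T (\<lambda>t. gamma2 T t * f t) a b"

end

theory Submission
  imports Defs "HOL-Analysis.Analysis"
begin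

text \<open>
  Put \<open>u = \<gamma>\<^sub>1 f\<close> and \<open>v = \<gamma>\<^sub>2 f\<close>. As \<open>\<gamma>\<^sub>1, \<gamma>\<^sub>2 \<ge> 0\<close> and \<open>\<gamma>\<^sub>1 + \<gamma>\<^sub>2 = 1\<close> on \<open>T\<close>, we have \<open>f = u + v\<close>, so
  \<open>\<gamma>\<^sub>1 |f|\<^sup>p = |u| |u + v|\<^sup>p\<^sup>-\<^sup>1\<close> and \<open>\<gamma>\<^sub>2 |f|\<^sup>p = |v| |u + v|\<^sup>p\<^sup>-\<^sup>1\<close> are continuous functions of \<open>u\<close> and \<open>v\<close>.
  Since \<open>u\<close> is only known to be delta integrable and \<open>v\<close> nabla integrable, integrability is
  characterized by a condition common to both integrals: boundedness together with partitions of
  arbitrarily small oscillation sum over the open cells.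

  The inequality follows from positivity and linearity of the diamond integral applied to the convexity
  bound \<open>(x + y)\<^sup>p \<le> l\<^sup>1\<^sup>-\<^sup>p x\<^sup>p + (1 - l)\<^sup>1\<^sup>-\<^sup>p y\<^sup>p\<close>, with \<open>l\<close> chosen in proportion to the two norms.
\<close>

section \<open>Partitions and tagged sums\<close>

text \<open>The delta and nabla sums differ only in the endpoint of a cell that may carry the tag.
  Making the cell shape \<open>C\<close> a parameter lets one proof serve both.\<close>

definition half_open :: "(real \<Rightarrow> real \<Rightarrow> real set) \<Rightarrow> bool" where
  "half_open C \<longleftrightarrow> C = atLeastLessThan \<or> C = greaterThanAtMost"

definition has_ts_integral ::
  "(real \<Rightarrow> real \<Rightarrow> real set) \<Rightarrow> real set \<Rightarrow> (real \<Rightarrow> real) \<Rightarrow> real \<Rightarrow> real \<Rightarrow> real \<Rightarrow> bool" where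
  "has_ts_integral C T f a b I \<longleftrightarrow>
     (\<forall>\<epsilon>>0. \<exists>\<delta>>0. \<forall>n t \<xi>.
        fine_partition T a b \<delta> n t \<and> (\<forall>i<n. \<xi> i \<in> C (t i) (t (Suc i)) \<inter> T) \<longrightarrow>
        \<bar>(\<Sum>i<n. f (\<xi> i) * (t (Suc i) - t i)) - I\<bar> < \<epsilon>)"

lemma half_open_Ico: "half_open atLeastLessThan"
  and half_open_Ioc: "half_open greaterThanAtMost"
  by (simp_all add: half_open_def)

lemma has_delta_integral_iff:
  "has_delta_integral T f a b I \<longleftrightarrow> has_ts_integral atLeastLessThan T f a b I"
  unfolding has_delta_integral_def has_ts_integral_def ..

lemma has_nabla_integral_iff:
  "has_nabla_integral T f a b I \<longleftrightarrow> has_ts_integral greaterThanAtMost T f a b I"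
  unfolding has_nabla_integral_def has_ts_integral_def ..

lemma has_ts_integralE:
  assumes "has_ts_integral C T f a b I" "\<epsilon> > 0"
  obtains \<delta> where "\<delta> > 0" "\<And>n t \<xi>. fine_partition T a b \<delta> n t \<Longrightarrow>
    (\<And>i. i < n \<Longrightarrow> \<xi> i \<in> C (t i) (t (Suc i)) \<inter> T) \<Longrightarrow>
    \<bar>(\<Sum>i<n. f (\<xi> i) * (t (Suc i) - t i)) - I\<bar> < \<epsilon>"
  using assms(1)[unfolded has_ts_integral_def, rule_format, OF assms(2)] by auto

lemma half_open_subset: "half_open C \<Longrightarrow> C u v \<subseteq> {u..v}"
  and half_open_superset: "half_open C \<Longrightarrow> {u<..<v} \<subseteq> C u v"
  and half_open_mono: "half_open C \<Longrightarrow> u' \<le> u \<Longrightarrow> v \<le> v' \<Longrightarrow> C u v \<subseteq> C u' v'"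
  and half_open_split: "half_open C \<Longrightarrow> C u v \<subseteq> C u m \<union> C m v"
  and half_open_disjoint: "half_open C \<Longrightarrow> v \<le> u' \<Longrightarrow> C u v \<inter> C u' v' = {}"
  by (auto simp: half_open_def)

lemma half_open_nonempty:
  assumes "half_open C" "u \<in> T" "v \<in> T" "u < v"
  shows "\<exists>x. x \<in> C u v \<inter> T"
  using assms by (auto simp: half_open_def)

lemma bwd_jump_gap:
  assumes "bwd_jump T v = u" "u \<in> T" "u < v" "s \<in> T" "s < v"
  shows "s \<le> u"
proof -
  have "s \<le> Sup {s \<in> T. s < v}"
    using assms by (intro cSup_upper bdd_aboveI[of _ v]) auto
  then show ?thesis using assms by (auto simp: bwd_jump_def split: if_splits)
qed

text \<open>A cell that spans a gap meets \<open>T\<close> in its endpoints only, and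
  \<open>C\<close> keeps exactly one of them. So the tag is forced, and the length of such a cell
  does no harm.\<close>

lemma half_open_gap:
  assumes "half_open C" "bwd_jump T v = u" "u \<in> T" "u < v" "x \<in> C u v \<inter> T" "y \<in> C u v \<inter> T"
  shows "x = y"
proof -
  have "s = u \<or> s = v" if "s \<in> T" "u \<le> s" "s \<le> v" for s
    using bwd_jump_gap[OF assms(2-4) that(1)] that by force
  from this[of x] this[of y] show ?thesis
    using assms(1,4-6) unfolding half_open_def by auto
qed

section \<open>Existence of fine partitions\<close>

lemma fine_partition_Cons:
  assumes "fine_partition T c b \<delta> n t" "a \<in> T" "a < c" "c - a \<le> \<delta> \<or> bwd_jump T c = a"
  shows "fine_partition T a b \<delta> (Suc n) (case_nat a t)"
  using assms unfolding fine_partition_def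
  by (auto simp: less_Suc_eq_0_disj le_Suc_eq split: nat.split)

lemma fine_partition_refl: "a \<in> T \<Longrightarrow> fine_partition T a a \<delta> 0 (\<lambda>_. a)"
  by (auto simp: fine_partition_def)

text \<open>Induction on the number \<open>k\<close> of steps of length \<open>\<delta>\<close> that
  cover the interval. With \<open>c\<close> the last point of \<open>T\<close> up to
  \<open>a + \<delta>\<close> and \<open>d\<close> the first one from there on, the short cell from
  \<open>a\<close> to \<open>c\<close> and the gap from \<open>c\<close> to \<open>d\<close> are put
  in front of a partition of the rest, which needs one step fewer. Either cell may be degenerate and
  is then omitted.\<close>

lemma fine_partition_exists:
  assumes T: "closed T" and b: "b \<in> T" and \<delta>: "\<delta> > 0" and "a \<in> T" "a \<le> b"
  shows "\<exists>n t. fine_partition T a b \<delta> n t"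
proof -
  obtain k :: nat where "b - a \<le> real k * \<delta>"
    using \<delta> by (meson ex_less_of_nat_mult less_imp_le)
  then show ?thesis
    using assms(4,5)
  proof (induction k arbitrary: a)
    case 0
    then show ?case using fine_partition_refl[of a] by force
  next
    case (Suc k)
    show ?case
    proof (cases "b \<le> a + \<delta>")
      case True
      show ?thesis
      proof (cases "a = b")
        case True
        then show ?thesis using fine_partition_refl[OF b] by blast
      next
        case False
        then show ?thesis
          using fine_partition_Cons[OF fine_partition_refl[OF b], of a \<delta>] Suc.prems True by force
      qed
    next
      case False
      define c where "c = Sup {s \<in> T. s \<le> a + \<delta>}"
      define d where "d = Inf {s \<in> T. s \<ge> a + \<delta>}"
      have bd: "bdd_above {s \<in> T. s \<le> a + \<delta>}" "bdd_below {s \<in> T. s \<ge> a + \<delta>}"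
        by (auto intro: bdd_aboveI bdd_belowI)
      have cl: "closed {s \<in> T. s \<le> a + \<delta>}" "closed {s \<in> T. s \<ge> a + \<delta>}"
        using T by (auto intro!: closed_Collect_conj closed_Collect_le continuous_intros)
      have c: "c \<in> T" "c \<le> a + \<delta>"
        using closed_contains_Sup[OF _ bd(1) cl(1)] Suc.prems \<delta> unfolding c_def by force+
      have d: "d \<in> T" "a + \<delta> \<le> d"
        using closed_contains_Inf[OF _ bd(2) cl(2)] b False unfolding d_def by force+
      have db: "d \<le> b"
        unfolding d_def using b False bd by (intro cInf_lower) auto
      have ac: "a \<le> c"
        unfolding c_def using Suc.prems \<delta> bd by (intro cSup_upper) auto
      obtain n t where nt: "fine_partition T d b \<delta> n t"
        using Suc.IH[of d] d db Suc.prems by (auto simp: algebra_simps)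
      obtain n' t' where nt': "fine_partition T c b \<delta> n' t'"
      proof (cases "c = d")
        case True
        then show ?thesis using that nt by blast
      next
        case False
        then have cd: "c < d" using c d by linarith
        \<comment> \<open>By minimality of \<open>d\<close>, a point of \<open>T\<close> below
          \<open>d\<close> cannot exceed \<open>a + \<delta>\<close>, hence is at most
          \<open>c\<close>. This makes the cell from \<open>c\<close> to \<open>d\<close> a
          gap.\<close>
        have "s \<le> c" if "s \<in> T" "s < d" for s
        proof -
          have "s \<le> a + \<delta>"
          proof (rule ccontr)
            assume "\<not> s \<le> a + \<delta>"
            then have "d \<le> s" unfolding d_def using that bd by (intro cInf_lower) auto
            with that show False by simp
          qed
          then show ?thesis unfolding c_def using that bd by (intro cSup_upper) auto
        qed
        then have "Sup {s \<in> T. s < d} = c"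
          using c cd by (intro cSup_eq_maximum) auto
        then have "bwd_jump T d = c" using c cd by (auto simp: bwd_jump_def)
        then show ?thesis using that fine_partition_Cons[OF nt c(1) cd] by blast
      qed
      show ?thesis
      proof (cases "a = c")
        case True
        then show ?thesis using nt' by blast
      next
        case False
        then show ?thesis
          using fine_partition_Cons[OF nt' Suc.prems(2)] ac c by fastforce
      qed
    qed
  qed
qed

section \<open>Cells and tags of a fine partition\<close>

lemma fine_partitionD:
  assumes "fine_partition T a b \<delta> n t"
  shows "t 0 = a" "t n = b" "\<And>i. i \<le> n \<Longrightarrow> t i \<in> T" "\<And>i. i < n \<Longrightarrow> t i < t (Suc i)"
    "\<And>i. i < n \<Longrightarrow> t (Suc i) - t i \<le> \<delta> \<or> bwd_jump T (t (Suc i)) = t i"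
  using assms by (auto simp: fine_partition_def)

lemma fine_partition_mono:
  "fine_partition T a b \<delta> n t \<Longrightarrow> \<delta> \<le> \<delta>' \<Longrightarrow> fine_partition T a b \<delta>' n t"
  unfolding fine_partition_def by force

lemma increasing_points_le:
  fixes t :: "nat \<Rightarrow> real"
  assumes "\<And>i. i < n \<Longrightarrow> t i < t (Suc i)" "i \<le> j" "j \<le> n"
  shows "t i \<le> t j"
  using assms(2,3)
proof (induction j rule: dec_induct)
  case (step k)
  then show ?case using assms(1)[of k] by simp
qed simp

lemma half_open_cell_exists:
  assumes "half_open C" "x \<in> C (t 0) (t n)"
  shows "\<exists>i<n. x \<in> C (t i) (t (Suc i))"
  using assms(2)
proof (induction n)
  case 0
  then show ?case using assms(1) by (auto simp: half_open_def)
next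
  case (Suc n)
  then show ?case using half_open_split[OF assms(1), of "t 0" "t (Suc n)" "t n"]
    by (metis (no_types, lifting) UnE less_Suc_eq subset_iff)
qed

lemma fine_partition_tags:
  assumes "half_open C" "fine_partition T a b \<delta> n t"
  obtains \<xi> where "\<And>i. i < n \<Longrightarrow> \<xi> i \<in> C (t i) (t (Suc i)) \<inter> T"
proof -
  have "\<exists>x. i < n \<longrightarrow> x \<in> C (t i) (t (Suc i)) \<inter> T" for i
    using half_open_nonempty[OF assms(1), of "t i" T "t (Suc i)"] fine_partitionD[OF assms(2)]
    by (cases "i < n") auto
  then show ?thesis using that by metis
qed

lemma fine_partition_cell_subset:
  assumes "half_open C" "fine_partition T a b \<delta> n t" "i < n"
  shows "C (t i) (t (Suc i)) \<subseteq> C a b"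
proof -
  note t = fine_partitionD[OF assms(2)]
  have "a \<le> t i" "t (Suc i) \<le> b"
    using increasing_points_le[of n t 0 i, OF t(4)] increasing_points_le[of n t "Suc i" n, OF t(4)]
      t(1,2) assms(3) by simp_all
  then show ?thesis using half_open_mono[OF assms(1)] by blast
qed

section \<open>Integrable functions have small oscillation sums\<close>

text \<open>The supremum of the differences may not be attained, but some pair reaches half of it.
  The factor 2 lets two tags stand for the oscillation over a whole cell.\<close>

lemma exists_nearly_maximal_oscillation:
  fixes h :: "'a \<Rightarrow> real"
  assumes "S \<noteq> {}" and bound: "\<And>x y. x \<in> S \<Longrightarrow> y \<in> S \<Longrightarrow> \<bar>h x - h y\<bar> \<le> B"
  shows "\<exists>x\<in>S. \<exists>y\<in>S. \<forall>x'\<in>S. \<forall>y'\<in>S. \<bar>h x' - h y'\<bar> \<le> 2 * \<bar>h x - h y\<bar>"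
proof (rule ccontr)
  define D where "D = (\<lambda>(x, y). \<bar>h x - h y\<bar>) ` (S \<times> S)"
  assume neg: "\<not> ?thesis"
  have bd: "bdd_above D" using bound by (auto simp: D_def intro!: bdd_aboveI[of _ B])
  obtain z where z: "z \<in> S" using assms by blast
  \<comment> \<open>For the pair \<open>(z, z)\<close> the negated claim provides a positive
    difference, so \<open>Sup D\<close> is positive and exceeds its half.\<close>
  obtain x y where xy: "x \<in> S" "y \<in> S" "\<bar>h x - h y\<bar> > 0"
    using neg z by (force simp: not_le)
  have "Sup D \<ge> \<bar>h x - h y\<bar>" using bd xy by (intro cSup_upper) (auto simp: D_def)
  then have "Sup D / 2 < Sup D" using xy by simp
  then obtain d where d: "d \<in> D" "Sup D / 2 < d"
    using less_cSup_iff[OF _ bd] z unfolding D_def by blast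
  then obtain x y where xy: "x \<in> S" "y \<in> S" "d = \<bar>h x - h y\<bar>" by (auto simp: D_def)
  have "\<bar>h x' - h y'\<bar> \<le> 2 * \<bar>h x - h y\<bar>" if "x' \<in> S" "y' \<in> S" for x' y'
  proof -
    have "\<bar>h x' - h y'\<bar> \<le> Sup D" using bd that by (intro cSup_upper) (auto simp: D_def)
    then show ?thesis using d xy by simp
  qed
  then show False using neg xy by blast
qed

text \<open>Two tagged sums over one partition both lie within \<open>\<epsilon> / 4\<close> of
  \<open>I\<close>. Tags chosen almost maximally apart turn the distance of the sums into a bound
  for the oscillation sum.\<close>

lemma has_ts_integral_oscillation:
  assumes C: "half_open C" and int: "has_ts_integral C T h a b I" and "\<epsilon> > 0"
  shows "\<exists>\<delta>>0. \<forall>n t. fine_partition T a b \<delta> n t \<longrightarrow> (\<exists>w.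
    (\<forall>i<n. \<forall>x\<in>C (t i) (t (Suc i)) \<inter> T. \<forall>y\<in>C (t i) (t (Suc i)) \<inter> T. \<bar>h x - h y\<bar> \<le> w i) \<and>
    (\<forall>i<n. 0 \<le> w i) \<and> (\<Sum>i<n. w i * (t (Suc i) - t i)) \<le> \<epsilon>)"
proof -
  obtain \<delta> where "\<delta> > 0" and \<delta>: "\<And>n t \<xi>. fine_partition T a b \<delta> n t \<Longrightarrow>
      (\<And>i. i < n \<Longrightarrow> \<xi> i \<in> C (t i) (t (Suc i)) \<inter> T) \<Longrightarrow>
      \<bar>(\<Sum>i<n. h (\<xi> i) * (t (Suc i) - t i)) - I\<bar> < \<epsilon> / 4"
    by (rule has_ts_integralE[OF int, of "\<epsilon> / 4"]) (use \<open>\<epsilon> > 0\<close> in auto)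
  show ?thesis
  proof (intro exI[of _ \<delta>] conjI \<open>\<delta> > 0\<close> allI impI)
    fix n t assume P: "fine_partition T a b \<delta> n t"
    note t = fine_partitionD[OF P]
    define S where "S i = C (t i) (t (Suc i)) \<inter> T" for i
    (* Exchanging the tags of the cells with a negative difference produces the absolute values. *)
    have sum_osc: "(\<Sum>i<n. \<bar>h (\<xi> i) - h (\<xi>' i)\<bar> * (t (Suc i) - t i)) \<le> \<epsilon> / 2"
      if "\<And>i. i < n \<Longrightarrow> \<xi> i \<in> S i" "\<And>i. i < n \<Longrightarrow> \<xi>' i \<in> S i" for \<xi> \<xi>'
    proof -
      define \<zeta> where "\<zeta> i = (if h (\<xi> i) \<ge> h (\<xi>' i) then \<xi> i else \<xi>' i)" for i
      define \<zeta>' where "\<zeta>' i = (if h (\<xi> i) \<ge> h (\<xi>' i) then \<xi>' i else \<xi> i)" for i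
      have "(\<Sum>i<n. \<bar>h (\<xi> i) - h (\<xi>' i)\<bar> * (t (Suc i) - t i)) =
          (\<Sum>i<n. h (\<zeta> i) * (t (Suc i) - t i)) - (\<Sum>i<n. h (\<zeta>' i) * (t (Suc i) - t i))"
        unfolding sum_subtractf[symmetric]
        by (rule sum.cong) (auto simp: \<zeta>_def \<zeta>'_def algebra_simps)
      moreover have "\<bar>(\<Sum>i<n. h (\<zeta> i) * (t (Suc i) - t i)) - I\<bar> < \<epsilon> / 4"
        by (rule \<delta>[OF P]) (use that in \<open>auto simp: S_def \<zeta>_def\<close>)
      moreover have "\<bar>(\<Sum>i<n. h (\<zeta>' i) * (t (Suc i) - t i)) - I\<bar> < \<epsilon> / 4"
        by (rule \<delta>[OF P]) (use that in \<open>auto simp: S_def \<zeta>'_def\<close>)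
      ultimately show ?thesis by linarith
    qed
    obtain \<xi>0 where \<xi>0: "\<And>i. i < n \<Longrightarrow> \<xi>0 i \<in> S i"
      using fine_partition_tags[OF C P] unfolding S_def by metis
    have "\<exists>x y. i < n \<longrightarrow> x \<in> S i \<and> y \<in> S i \<and> (\<forall>x'\<in>S i. \<forall>y'\<in>S i. \<bar>h x' - h y'\<bar> \<le> 2 * \<bar>h x - h y\<bar>)" for i
    proof (cases "i < n")
      case True
      \<comment> \<open>Moving the tag of cell \<open>i\<close> alone shows that \<open>h\<close>
        has finite oscillation there, as the choice of a nearly maximal pair requires.\<close>
      have "\<bar>h x - h y\<bar> \<le> \<epsilon> / 2 / (t (Suc i) - t i)" if "x \<in> S i" "y \<in> S i" for x y
      proof -
        have "\<bar>h x - h y\<bar> * (t (Suc i) - t i) \<le>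
            (\<Sum>j<n. \<bar>h ((\<xi>0(i:=x)) j) - h ((\<xi>0(i:=y)) j)\<bar> * (t (Suc j) - t j))"
          using member_le_sum[of i "{..<n}" "\<lambda>j. \<bar>h ((\<xi>0(i:=x)) j) - h ((\<xi>0(i:=y)) j)\<bar> * (t (Suc j) - t j)"]
            True t(4) by (auto simp: less_imp_le)
        also have "\<dots> \<le> \<epsilon> / 2" by (rule sum_osc) (use \<xi>0 that in auto)
        finally show ?thesis using t(4)[OF True] by (simp add: field_simps)
      qed
      then show ?thesis
        using exists_nearly_maximal_oscillation[of "S i" h] \<xi>0[OF True] by blast
    qed auto
    then obtain X Y where XY: "\<And>i. i < n \<Longrightarrow> X i \<in> S i" "\<And>i. i < n \<Longrightarrow> Y i \<in> S i"
      "\<And>i x y. i < n \<Longrightarrow> x \<in> S i \<Longrightarrow> y \<in> S i \<Longrightarrow> \<bar>h x - h y\<bar> \<le> 2 * \<bar>h (X i) - h (Y i)\<bar>"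
      by metis
    have "(\<Sum>i<n. 2 * \<bar>h (X i) - h (Y i)\<bar> * (t (Suc i) - t i)) =
        2 * (\<Sum>i<n. \<bar>h (X i) - h (Y i)\<bar> * (t (Suc i) - t i))"
      by (simp add: sum_distrib_left mult.assoc)
    also have "\<dots> \<le> \<epsilon>" using sum_osc[OF XY(1,2)] by simp
    finally show "\<exists>w. (\<forall>i<n. \<forall>x\<in>C (t i) (t (Suc i)) \<inter> T. \<forall>y\<in>C (t i) (t (Suc i)) \<inter> T. \<bar>h x - h y\<bar> \<le> w i) \<and>
        (\<forall>i<n. 0 \<le> w i) \<and> (\<Sum>i<n. w i * (t (Suc i) - t i)) \<le> \<epsilon>"
      using XY(3) by (intro exI[of _ "\<lambda>i. 2 * \<bar>h (X i) - h (Y i)\<bar>"]) (auto simp: S_def)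
  qed
qed

section \<open>The oscillation criterion\<close>

text \<open>Covers open, closed and half-open intervals at once: \<open>S\<close> and
  \<open>{u..v}\<close> differ at most in the endpoints, a negligible set.\<close>

lemma has_integral_indicator_interval:
  fixes u v :: real
  assumes "u \<le> v" "{u<..<v} \<subseteq> S" "S \<subseteq> {u..v}"
  shows "(indicat_real S has_integral (v - u)) UNIV"
proof -
  have "((\<lambda>_. 1::real) has_integral (v - u)) {u..v}"
    using has_integral_const_real[of "1::real" u v] assms(1) by simp
  then have "((\<lambda>x. if x \<in> {u..v} then 1 else 0) has_integral (v - u)) UNIV"
    by (simp only: has_integral_restrict_UNIV)
  then show ?thesis
    by (rule has_integral_spike_finite[of "{u, v}", rotated 2])
       (use assms(2,3) in \<open>auto simp: indicator_def\<close>)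
qed

text \<open>Rounding down to \<open>T\<close> stays in \<open>{u..<v}\<close> and rounding up stays
  in \<open>{u<..v}\<close>, because the endpoints belong to \<open>T\<close>; closedness puts the
  rounded value in \<open>T\<close>. One \<open>\<tau>\<close> serves all cells, so it depends on no
  partition.\<close>

lemma half_open_retraction:
  assumes "half_open C" "closed T"
  obtains \<tau> where "\<And>u v x. u \<in> T \<Longrightarrow> v \<in> T \<Longrightarrow> x \<in> C u v \<Longrightarrow> \<tau> x \<in> C u v \<inter> T"
proof (cases "C = atLeastLessThan")
  case True
  define \<tau> where "\<tau> x = Sup {s \<in> T. s \<le> x}" for x
  show ?thesis
  proof (rule that[of \<tau>])
    fix u v x assume *: "u \<in> T" "v \<in> T" "x \<in> C u v"
    have bd: "bdd_above {s \<in> T. s \<le> x}" by (auto intro: bdd_aboveI)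
    have "closed {s \<in> T. s \<le> x}"
      using assms(2) by (auto intro!: closed_Collect_conj closed_Collect_le continuous_intros)
    then have "\<tau> x \<in> T" "\<tau> x \<le> x"
      using closed_contains_Sup[OF _ bd] * True unfolding \<tau>_def by fastforce+
    moreover have "u \<le> \<tau> x" unfolding \<tau>_def using * True bd by (intro cSup_upper) auto
    ultimately show "\<tau> x \<in> C u v \<inter> T" using True * by auto
  qed
next
  case False
  then have C: "C = greaterThanAtMost" using assms(1) by (simp add: half_open_def)
  define \<tau> where "\<tau> x = Inf {s \<in> T. s \<ge> x}" for x
  show ?thesis
  proof (rule that[of \<tau>])
    fix u v x assume *: "u \<in> T" "v \<in> T" "x \<in> C u v"
    have bd: "bdd_below {s \<in> T. s \<ge> x}" by (auto intro: bdd_belowI)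
    have "closed {s \<in> T. s \<ge> x}"
      using assms(2) by (auto intro!: closed_Collect_conj closed_Collect_le continuous_intros)
    then have "\<tau> x \<in> T" "x \<le> \<tau> x"
      using closed_contains_Inf[OF _ bd] * C unfolding \<tau>_def by fastforce+
    moreover have "\<tau> x \<le> v" unfolding \<tau>_def using * C bd by (intro cInf_lower) auto
    ultimately show "\<tau> x \<in> C u v \<inter> T" using C * by auto
  qed
qed

text \<open>
  The oscillation is measured on the open cells only, so the hypothesis does not depend on \<^term>\<open>C\<close>:
  this is what passes from nabla to delta integrability and back. The endpoints of a fixed
  partition are covered by intervals of radius \<open>\<delta>\<close>, where the crude bound \<open>2 * M\<close> suffices. The
  integral is that of the extension of \<^term>\<open>h\<close> that is constant on the gaps of \<^term>\<open>T\<close>.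
\<close>

lemma has_ts_integral_if_oscillation:
  assumes C: "half_open C" and T: "closed T" "a \<in> T" "b \<in> T" "a < b"
    and M: "\<And>x. x \<in> T \<inter> {a..b} \<Longrightarrow> \<bar>h x\<bar> \<le> M"
    and osc: "\<And>\<epsilon>. \<epsilon> > 0 \<Longrightarrow> \<exists>n t w. t 0 = a \<and> t n = b \<and> (\<forall>i<n. t i < t (Suc i) \<and> 0 \<le> w i) \<and>
      (\<forall>i<n. \<forall>x\<in>T \<inter> {t i<..<t (Suc i)}. \<forall>y\<in>T \<inter> {t i<..<t (Suc i)}. \<bar>h x - h y\<bar> \<le> w i) \<and>
      (\<Sum>i<n. w i * (t (Suc i) - t i)) \<le> \<epsilon>"
  shows "\<exists>I. has_ts_integral C T h a b I"
proof -
  obtain \<tau> where \<tau>: "\<And>u v x. u \<in> T \<Longrightarrow> v \<in> T \<Longrightarrow> x \<in> C u v \<Longrightarrow> \<tau> x \<in> C u v \<inter> T"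
    using half_open_retraction[OF C T(1)] by metis
  \<comment> \<open>\<open>F\<close> is the candidate integrand on the real line and
    \<open>step\<close> the step function of a tagged partition, so that tagged sums become
    integrals over the reals.\<close>
  define F where "F x = (if x \<in> C a b then h (\<tau> x) else 0)" for x
  define step where
    "step n t \<xi> x = (\<Sum>i<n. h (\<xi> i) * indicat_real (C (t i) (t (Suc i))) x)" for n t \<xi> x
  have M0: "M \<ge> 0" using M[of a] T by auto
  have step_integral:
    "(step n t \<xi> has_integral (\<Sum>i<n. h (\<xi> i) * (t (Suc i) - t i))) UNIV"
    if "fine_partition T a b \<delta> n t" for \<delta> n t \<xi>
    unfolding step_def
    using half_open_subset[OF C] half_open_superset[OF C] fine_partitionD(4)[OF that]
    by (intro has_integral_sum has_integral_mult_right has_integral_indicator_interval)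
       (auto simp: less_imp_le)
  \<comment> \<open>The core of the proof: one majorant \<open>G\<close> of small integral works for
    all \<open>\<delta>\<close>-fine tagged partitions simultaneously.\<close>
  have approx: "\<exists>\<delta>>0. \<exists>G J. (G has_integral J) UNIV \<and> J \<le> \<epsilon> \<and>
      (\<forall>n t \<xi> x. fine_partition T a b \<delta> n t \<and> (\<forall>i<n. \<xi> i \<in> C (t i) (t (Suc i)) \<inter> T) \<longrightarrow>
        \<bar>step n t \<xi> x - F x\<bar> \<le> G x)" if \<epsilon>: "\<epsilon> > 0" for \<epsilon> :: real
  proof -
    obtain N P w where P': "P 0 = a \<and> P N = b \<and> (\<forall>i<N. P i < P (Suc i) \<and> 0 \<le> w i) \<and>
      (\<forall>i<N. \<forall>x\<in>T \<inter> {P i<..<P (Suc i)}. \<forall>y\<in>T \<inter> {P i<..<P (Suc i)}. \<bar>h x - h y\<bar> \<le> w i) \<and>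
      (\<Sum>i<N. w i * (P (Suc i) - P i)) \<le> \<epsilon> / 2"
      using osc[OF half_gt_zero[OF \<epsilon>]] by blast
    then have P: "P 0 = a" "P N = b" "\<And>i. i < N \<Longrightarrow> P i < P (Suc i)" "\<And>i. i < N \<Longrightarrow> 0 \<le> w i"
      "\<And>i x y. i < N \<Longrightarrow> x \<in> T \<inter> {P i<..<P (Suc i)} \<Longrightarrow> y \<in> T \<inter> {P i<..<P (Suc i)} \<Longrightarrow> \<bar>h x - h y\<bar> \<le> w i"
      "(\<Sum>i<N. w i * (P (Suc i) - P i)) \<le> \<epsilon> / 2"
      by blast+
    \<comment> \<open>The \<open>N + 1\<close> intervals of length \<open>2 * \<delta>\<close> and
      height \<open>2 * M\<close> contribute at most \<open>\<epsilon> / 2\<close>. Writing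
      \<open>M + 1\<close> keeps the denominator positive when \<open>M = 0\<close>.\<close>
    define \<delta> where "\<delta> = \<epsilon> / (8 * (M + 1) * (real N + 1))"
    have \<delta>: "\<delta> > 0" using \<epsilon> M0 by (simp add: \<delta>_def)
    define G where "G x = (\<Sum>i<N. w i * indicat_real {P i<..<P (Suc i)} x) +
        (\<Sum>i\<le>N. 2 * M * indicat_real {P i - \<delta>..P i + \<delta>} x)" for x
    have sub: "{P i<..<P (Suc i)} \<subseteq> {P i..P (Suc i)}" for i by auto
    have "(G has_integral (\<Sum>i<N. w i * (P (Suc i) - P i)) +
        (\<Sum>i\<le>N. 2 * M * ((P i + \<delta>) - (P i - \<delta>)))) UNIV"
      unfolding G_def using \<delta> P(3) sub
      by (intro has_integral_add has_integral_sum has_integral_mult_right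
          has_integral_indicator_interval) (auto simp: less_imp_le greaterThanLessThan_subseteq_atLeastAtMost_iff)
    moreover have "(\<Sum>i<N. w i * (P (Suc i) - P i)) + (\<Sum>i\<le>N. 2 * M * ((P i + \<delta>) - (P i - \<delta>))) \<le> \<epsilon>"
    proof -
      have "(\<Sum>i\<le>N. 2 * M * ((P i + \<delta>) - (P i - \<delta>))) = 4 * M * (real N + 1) * \<delta>"
        by simp
      also have "\<dots> \<le> 4 * (M + 1) * (real N + 1) * \<delta>"
        using \<delta> by (intro mult_right_mono) auto
      also have "\<dots> = \<epsilon> / 2"
        using M0 by (simp add: \<delta>_def divide_simps)
      finally show ?thesis using P(6) by linarith
    qed
    moreover have "\<bar>step n t \<xi> x - F x\<bar> \<le> G x"
      if Q: "fine_partition T a b \<delta> n t" and \<xi>: "\<And>i. i < n \<Longrightarrow> \<xi> i \<in> C (t i) (t (Suc i)) \<inter> T" for n t \<xi> x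
    proof -
      note t = fine_partitionD[OF Q]
      have tmono: "t i \<le> t j" if "i \<le> j" "j \<le> n" for i j
        using increasing_points_le[of n t, OF t(4)] that by blast
      note cell_sub = fine_partition_cell_subset[OF C Q]
      have nonneg: "0 \<le> (\<Sum>i<N. w i * indicat_real {P i<..<P (Suc i)} x)"
        "0 \<le> (\<Sum>i\<le>N. 2 * M * indicat_real {P i - \<delta>..P i + \<delta>} x)"
        using P(4) M0 by (auto intro!: sum_nonneg)
      show ?thesis
      proof (cases "x \<in> C a b")
        case False
        then have "step n t \<xi> x = 0"
          unfolding step_def using cell_sub by (intro sum.neutral) (auto simp: indicator_def)
        then show ?thesis using False nonneg by (simp add: F_def G_def)
      next
        case True
        then obtain j where j: "j < n" "x \<in> C (t j) (t (Suc j))"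
          using half_open_cell_exists[OF C, of x t n] t(1,2) by blast
        have other: "x \<notin> C (t i) (t (Suc i))" if "i < n" "i \<noteq> j" for i
        proof (cases "i < j")
          case True
          then show ?thesis
            using half_open_disjoint[OF C, of "t (Suc i)" "t j" "t i"] tmono[of "Suc i" j] j by auto
        next
          case False
          then show ?thesis
            using half_open_disjoint[OF C, of "t (Suc j)" "t i" "t j"] tmono[of "Suc j" i] j that by auto
        qed
        have "step n t \<xi> x = (\<Sum>i<n. if i = j then h (\<xi> j) else 0)"
          unfolding step_def using j(2) other by (intro sum.cong) (auto simp: indicator_def)
        then have step: "step n t \<xi> x = h (\<xi> j)" using j(1) by simp
        have tx: "\<tau> x \<in> C (t j) (t (Suc j)) \<inter> T"
          using \<tau>[OF t(3)[of j] t(3)[of "Suc j"]] j by simp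
        note \<xi>j = \<xi>[OF j(1)]
        have in_ab: "C (t j) (t (Suc j)) \<subseteq> {a..b}"
          using cell_sub[OF j(1)] half_open_subset[OF C] by blast
        have bound: "\<bar>h (\<xi> j) - h (\<tau> x)\<bar> \<le> 2 * M"
          using M[of "\<xi> j"] M[of "\<tau> x"] tx \<xi>j in_ab by fastforce
        have "\<bar>h (\<xi> j) - h (\<tau> x)\<bar> \<le> G x"
          using t(5)[OF j(1)]
        proof
          assume "bwd_jump T (t (Suc j)) = t j"
          then have "\<xi> j = \<tau> x"
            using half_open_gap[OF C _ _ _ \<xi>j tx] t(3)[of j] t(4) j by simp
          then show ?thesis using nonneg by (simp add: G_def)
        next
          assume small: "t (Suc j) - t j \<le> \<delta>"
          have cl: "\<xi> j \<in> {t j..t (Suc j)}" "x \<in> {t j..t (Suc j)}" "\<tau> x \<in> {t j..t (Suc j)}"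
            using half_open_subset[OF C] \<xi>j j tx by blast+
          \<comment> \<open>A short cell that meets a node of \<open>P\<close> puts \<open>x\<close>
            within \<open>\<delta>\<close> of that node, where \<open>G\<close> is at least
            \<open>2 * M\<close>. Otherwise the cell lies inside one open cell of \<open>P\<close>,
            and \<open>w i\<close> bounds the difference.\<close>
          show ?thesis
          proof (cases "\<exists>i\<le>N. P i \<in> {t j..t (Suc j)}")
            case True
            then obtain i where i: "i \<le> N" "P i \<in> {t j..t (Suc j)}" by blast
            then have "x \<in> {P i - \<delta>..P i + \<delta>}" using small cl by auto
            then have "2 * M \<le> (\<Sum>i\<le>N. 2 * M * indicat_real {P i - \<delta>..P i + \<delta>} x)"
              using member_le_sum[of i "{..N}" "\<lambda>i. 2 * M * indicat_real {P i - \<delta>..P i + \<delta>} x"] i M0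
              by simp
            then show ?thesis using bound nonneg by (simp add: G_def)
          next
            case False
            obtain i where i: "i < N" "\<xi> j \<in> C (P i) (P (Suc i))"
              using half_open_cell_exists[OF C, of "\<xi> j" P N] P(1,2) \<xi>j cell_sub[OF j(1)] by blast
            then have "\<xi> j \<in> {P i..P (Suc i)}" using half_open_subset[OF C] by blast
            moreover have F1: "P i \<notin> {t j..t (Suc j)}" and F2: "P (Suc i) \<notin> {t j..t (Suc j)}"
              using False i(1) by auto
            ultimately have "{t j..t (Suc j)} \<subseteq> {P i<..<P (Suc i)}"
              using F1 F2 cl(1) by fastforce
            then have "\<bar>h (\<xi> j) - h (\<tau> x)\<bar> \<le> w i" "x \<in> {P i<..<P (Suc i)}"
              using P(5)[OF i(1), of "\<xi> j" "\<tau> x"] cl \<xi>j tx by blast+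
            moreover have "w i * indicat_real {P i<..<P (Suc i)} x \<le>
                (\<Sum>i<N. w i * indicat_real {P i<..<P (Suc i)} x)"
              using member_le_sum[of i "{..<N}" "\<lambda>i. w i * indicat_real {P i<..<P (Suc i)} x"] i P(4)
              by simp
            ultimately have "\<bar>h (\<xi> j) - h (\<tau> x)\<bar> \<le> (\<Sum>i<N. w i * indicat_real {P i<..<P (Suc i)} x)"
              by simp
            then show ?thesis using nonneg(2) unfolding G_def by linarith
          qed
        qed
        then show ?thesis using step True by (simp add: F_def)
      qed
    qed
    ultimately show ?thesis using \<delta> by blast
  qed
  \<comment> \<open>\<open>F\<close> is squeezed between the step function minus \<open>G\<close>
    and the step function plus \<open>G\<close>, whose integrals differ by \<open>2 * J\<close>, at
    most \<open>e / 2\<close>.\<close>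
  have "F integrable_on UNIV"
  proof (rule integrable_straddle)
    fix e :: real assume "e > 0"
    then obtain \<delta> G J where \<delta>: "\<delta> > 0" and G: "(G has_integral J) UNIV" "J \<le> e / 4"
      and bound: "\<And>n t \<xi> x. fine_partition T a b \<delta> n t \<Longrightarrow> (\<And>i. i < n \<Longrightarrow> \<xi> i \<in> C (t i) (t (Suc i)) \<inter> T) \<Longrightarrow>
        \<bar>step n t \<xi> x - F x\<bar> \<le> G x"
      using approx[of "e / 4"] by auto
    obtain n t where P: "fine_partition T a b \<delta> n t"
      using fine_partition_exists[OF T(1,3) \<delta> T(2)] T(4) by auto
    obtain \<xi> where \<xi>: "\<And>i. i < n \<Longrightarrow> \<xi> i \<in> C (t i) (t (Suc i)) \<inter> T"
      using fine_partition_tags[OF C P] by metis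
    let ?S = "\<Sum>i<n. h (\<xi> i) * (t (Suc i) - t i)"
    have ge: "\<bar>step n t \<xi> x - F x\<bar> \<le> G x" for x using bound[OF P \<xi>] .
    have "0 \<le> G x" for x using ge[of x] by linarith
    then have "0 \<le> J" using has_integral_nonneg[OF G(1)] by simp
    have "((\<lambda>x. step n t \<xi> x - G x) has_integral ?S - J) UNIV"
      "((\<lambda>x. step n t \<xi> x + G x) has_integral ?S + J) UNIV"
      using step_integral[OF P] G(1) by (auto intro: has_integral_diff has_integral_add)
    moreover have "\<bar>(?S - J) - (?S + J)\<bar> < e" using \<open>0 \<le> J\<close> G(2) \<open>e > 0\<close> by simp
    moreover have "step n t \<xi> x - G x \<le> F x \<and> F x \<le> step n t \<xi> x + G x" for x
      using ge[of x] by linarith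
    ultimately show "\<exists>g h i j. (g has_integral i) UNIV \<and> (h has_integral j) UNIV \<and>
        \<bar>i - j\<bar> < e \<and> (\<forall>x\<in>UNIV. g x \<le> F x \<and> F x \<le> h x)"
      by blast
  qed
  then have F: "(F has_integral integral UNIV F) UNIV" by (rule integrable_integral)
  \<comment> \<open>Integrating the bounds \<open>- G\<close> and \<open>G\<close> for the
    difference of the step function and \<open>F\<close> puts every fine tagged sum within
    \<open>J\<close> of the integral of \<open>F\<close>.\<close>
  have "has_ts_integral C T h a b (integral UNIV F)"
    unfolding has_ts_integral_def
  proof (intro allI impI)
    fix \<epsilon> :: real assume "\<epsilon> > 0"
    then obtain \<delta> G J where \<delta>: "\<delta> > 0" and G: "(G has_integral J) UNIV" "J \<le> \<epsilon> / 2"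
      and bound: "\<And>n t \<xi> x. fine_partition T a b \<delta> n t \<Longrightarrow> (\<And>i. i < n \<Longrightarrow> \<xi> i \<in> C (t i) (t (Suc i)) \<inter> T) \<Longrightarrow>
        \<bar>step n t \<xi> x - F x\<bar> \<le> G x"
      using approx[of "\<epsilon> / 2"] by auto
    show "\<exists>\<delta>>0. \<forall>n t \<xi>. fine_partition T a b \<delta> n t \<and> (\<forall>i<n. \<xi> i \<in> C (t i) (t (Suc i)) \<inter> T) \<longrightarrow>
        \<bar>(\<Sum>i<n. h (\<xi> i) * (t (Suc i) - t i)) - integral UNIV F\<bar> < \<epsilon>"
    proof (intro exI[of _ \<delta>] conjI \<delta> allI impI; elim conjE)
      fix n t \<xi> assume P: "fine_partition T a b \<delta> n t" and \<xi>: "\<forall>i<n. \<xi> i \<in> C (t i) (t (Suc i)) \<inter> T"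
      have ge: "\<bar>step n t \<xi> x - F x\<bar> \<le> G x" for x using bound[OF P] \<xi> by blast
      let ?S = "\<Sum>i<n. h (\<xi> i) * (t (Suc i) - t i)"
      have lower: "- G x \<le> step n t \<xi> x - F x" and upper: "step n t \<xi> x - F x \<le> G x" for x
        using ge[of x] by linarith+
      have d: "((\<lambda>x. step n t \<xi> x - F x) has_integral ?S - integral UNIV F) UNIV"
        using step_integral[OF P] F by (rule has_integral_diff)
      have "?S - integral UNIV F \<le> J"
        by (rule has_integral_le[OF d G(1)]) (rule upper)
      moreover have "- J \<le> ?S - integral UNIV F"
        by (rule has_integral_le[OF has_integral_neg[OF G(1)] d]) (rule lower)
      ultimately show "\<bar>?S - integral UNIV F\<bar> < \<epsilon>" using G(2) \<open>\<epsilon> > 0\<close> by linarith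
    qed
  qed
  then show ?thesis by blast
qed

section \<open>Boundedness, and continuous functions of integrable functions\<close>

text \<open>In each cell of one fine partition \<open>h\<close> stays within \<open>w i\<close> of
  its value at the tag; a sum over the cells replaces the maximum. The values at \<open>a\<close>
  and \<open>b\<close> are added because \<open>C a b\<close> omits one of these endpoints.\<close>

lemma has_ts_integral_bounded:
  assumes C: "half_open C" and T: "closed T" "a \<in> T" "b \<in> T" "a < b"
    and h: "has_ts_integral C T h a b I"
  shows "\<exists>M. \<forall>x\<in>T \<inter> {a..b}. \<bar>h x\<bar> \<le> M"
proof -
  obtain \<delta> where "\<delta> > 0" and osc: "\<forall>n t. fine_partition T a b \<delta> n t \<longrightarrow> (\<exists>w.
      (\<forall>i<n. \<forall>x\<in>C (t i) (t (Suc i)) \<inter> T. \<forall>y\<in>C (t i) (t (Suc i)) \<inter> T. \<bar>h x - h y\<bar> \<le> w i) \<and>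
      (\<forall>i<n. 0 \<le> w i) \<and> (\<Sum>i<n. w i * (t (Suc i) - t i)) \<le> 1)"
    using has_ts_integral_oscillation[OF C h zero_less_one] by blast
  then obtain n t where P: "fine_partition T a b \<delta> n t"
    using fine_partition_exists[OF T(1,3) _ T(2), of \<delta>] T(4) by auto
  obtain w where w: "\<And>i x y. i < n \<Longrightarrow> x \<in> C (t i) (t (Suc i)) \<inter> T \<Longrightarrow> y \<in> C (t i) (t (Suc i)) \<inter> T \<Longrightarrow> \<bar>h x - h y\<bar> \<le> w i"
    "\<And>i. i < n \<Longrightarrow> 0 \<le> w i"
    using osc[rule_format, OF P] by blast
  obtain \<xi> where \<xi>: "\<And>i. i < n \<Longrightarrow> \<xi> i \<in> C (t i) (t (Suc i)) \<inter> T"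
    using fine_partition_tags[OF C P] by metis
  define S where "S = (\<Sum>i<n. \<bar>h (\<xi> i)\<bar> + w i)"
  have S0: "0 \<le> S" unfolding S_def using w(2) by (intro sum_nonneg) auto
  have "\<bar>h x\<bar> \<le> \<bar>h a\<bar> + \<bar>h b\<bar> + S" if x: "x \<in> T \<inter> {a..b}" for x
  proof (cases "x = a \<or> x = b")
    case True
    then show ?thesis using S0 by auto
  next
    case False
    then have "x \<in> C (t 0) (t n)"
      using half_open_superset[OF C, of a b] x fine_partitionD(1,2)[OF P] by force
    then obtain i where i: "i < n" "x \<in> C (t i) (t (Suc i))"
      using half_open_cell_exists[OF C] by blast
    have "\<bar>h x - h (\<xi> i)\<bar> \<le> w i" using w(1)[OF i(1) _ \<xi>[OF i(1)], of x] i(2) x by simp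
    then have "\<bar>h x\<bar> \<le> \<bar>h (\<xi> i)\<bar> + w i" by linarith
    also have "\<dots> \<le> S"
      unfolding S_def using w(2) i(1)
      by (intro member_le_sum[of i "{..<n}" "\<lambda>i. \<bar>h (\<xi> i)\<bar> + w i"]) auto
    finally show ?thesis by linarith
  qed
  then show ?thesis by blast
qed

text \<open>The three cell shapes are independent, which allows delta and nabla integrability to be
  mixed. The pairs \<open>(u x, v x)\<close> range over a compact set where \<open>\<Phi>\<close> is
  bounded and uniformly continuous, so the oscillation of the composite is controlled by those of
  \<open>u\<close> and \<open>v\<close> over a common partition.\<close>

lemma has_ts_integral_compose2:
  fixes \<Phi> :: "real \<times> real \<Rightarrow> real"
  assumes C: "half_open C" "half_open C1" "half_open C2"
    and T: "closed T" "a \<in> T" "b \<in> T" "a < b"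
    and u: "has_ts_integral C1 T u a b I1" and v: "has_ts_integral C2 T v a b I2"
    and \<Phi>: "continuous_on UNIV \<Phi>"
  shows "\<exists>I. has_ts_integral C T (\<lambda>x. \<Phi> (u x, v x)) a b I"
proof -
  obtain M1 where M1: "\<And>x. x \<in> T \<inter> {a..b} \<Longrightarrow> \<bar>u x\<bar> \<le> M1"
    using has_ts_integral_bounded[OF C(2) T u] by blast
  obtain M2 where M2: "\<And>x. x \<in> T \<inter> {a..b} \<Longrightarrow> \<bar>v x\<bar> \<le> M2"
    using has_ts_integral_bounded[OF C(3) T v] by blast
  define K where "K = {- M1..M1} \<times> {- M2..M2}"
  have K: "(u x, v x) \<in> K" if "x \<in> T \<inter> {a..b}" for x
    using M1[OF that] M2[OF that] by (auto simp: K_def)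
  have compact: "compact K" unfolding K_def by (intro compact_Times compact_Icc)
  have cont: "continuous_on K \<Phi>" using \<Phi> by (rule continuous_on_subset) simp
  have uc: "uniformly_continuous_on K \<Phi>" by (rule compact_uniformly_continuous[OF cont compact])
  obtain B where B: "\<And>z. z \<in> K \<Longrightarrow> \<bar>\<Phi> z\<bar> \<le> B"
    using compact_imp_bounded[OF compact_continuous_image[OF cont compact]]
    unfolding bounded_iff by auto
  have B0: "B \<ge> 0" using B[OF K[of a]] T by auto
  show ?thesis
  proof (rule has_ts_integral_if_oscillation[OF C(1) T, where M = B])
    fix x assume "x \<in> T \<inter> {a..b}"
    then show "\<bar>\<Phi> (u x, v x)\<bar> \<le> B" by (intro B K)
  next
    fix \<epsilon> :: real assume \<epsilon>: "\<epsilon> > 0"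
    \<comment> \<open>Spread over the total length \<open>b - a\<close>, this amounts to
      \<open>\<epsilon> / 2\<close>.\<close>
    define \<epsilon>' where "\<epsilon>' = \<epsilon> / 2 / (b - a)"
    have \<epsilon>': "\<epsilon>' > 0" using \<epsilon> T by (simp add: \<epsilon>'_def)
    obtain \<eta> where \<eta>: "\<eta> > 0" "\<And>z z'. z \<in> K \<Longrightarrow> z' \<in> K \<Longrightarrow> dist z' z < \<eta> \<Longrightarrow> dist (\<Phi> z') (\<Phi> z) < \<epsilon>'"
      using uc \<epsilon>' unfolding uniformly_continuous_on_def by metis
    \<comment> \<open>With this slope the linear term reaches \<open>2 * B\<close> once the
      coordinate differences add up to \<open>\<eta>\<close>. So \<open>modulus\<close> holds far
      away by boundedness and nearby by uniform continuity.\<close>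
    define L where "L = 2 * B / \<eta>"
    have L0: "L \<ge> 0" using B0 \<eta> by (simp add: L_def)
    have modulus: "\<bar>\<Phi> (p, q) - \<Phi> (p', q')\<bar> \<le> \<epsilon>' + L * (\<bar>p - p'\<bar> + \<bar>q - q'\<bar>)"
      if "(p, q) \<in> K" "(p', q') \<in> K" for p q p' q'
    proof (cases "\<bar>p - p'\<bar> + \<bar>q - q'\<bar> < \<eta>")
      case True
      have "dist (p, q) (p', q') \<le> \<bar>p - p'\<bar> + \<bar>q - q'\<bar>"
        using sqrt_sum_squares_le_sum_abs[of "p - p'" "q - q'"] by (simp add: dist_Pair_Pair dist_real_def)
      then have "dist (\<Phi> (p, q)) (\<Phi> (p', q')) < \<epsilon>'" using True \<eta>(2) that by simp
      moreover have "0 \<le> L * (\<bar>p - p'\<bar> + \<bar>q - q'\<bar>)" using L0 by simp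
      ultimately show ?thesis unfolding dist_real_def by linarith
    next
      case False
      have "\<bar>\<Phi> (p, q) - \<Phi> (p', q')\<bar> \<le> 2 * B" using B[OF that(1)] B[OF that(2)] by linarith
      also have "\<dots> = L * \<eta>" using \<eta> by (simp add: L_def)
      also have "\<dots> \<le> L * (\<bar>p - p'\<bar> + \<bar>q - q'\<bar>)" using False L0 by (intro mult_left_mono) auto
      finally show ?thesis using \<epsilon>' by linarith
    qed
    \<comment> \<open>Two oscillation sums of at most \<open>e\<close>, weighted by
      \<open>L\<close>, amount to at most \<open>\<epsilon> / 2\<close>; \<open>L + 1\<close> keeps
      the denominator positive when \<open>L = 0\<close>.\<close>
    define e where "e = \<epsilon> / (4 * (L + 1))"
    have e: "e > 0" using \<epsilon> L0 by (simp add: e_def)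
    obtain \<delta>1 where d1: "\<delta>1 > 0" "\<forall>n t. fine_partition T a b \<delta>1 n t \<longrightarrow> (\<exists>w.
      (\<forall>i<n. \<forall>x\<in>C1 (t i) (t (Suc i)) \<inter> T. \<forall>y\<in>C1 (t i) (t (Suc i)) \<inter> T. \<bar>u x - u y\<bar> \<le> w i) \<and>
      (\<forall>i<n. 0 \<le> w i) \<and> (\<Sum>i<n. w i * (t (Suc i) - t i)) \<le> e)"
      using has_ts_integral_oscillation[OF C(2) u e] by blast
    obtain \<delta>2 where d2: "\<delta>2 > 0" "\<forall>n t. fine_partition T a b \<delta>2 n t \<longrightarrow> (\<exists>w.
      (\<forall>i<n. \<forall>x\<in>C2 (t i) (t (Suc i)) \<inter> T. \<forall>y\<in>C2 (t i) (t (Suc i)) \<inter> T. \<bar>v x - v y\<bar> \<le> w i) \<and>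
      (\<forall>i<n. 0 \<le> w i) \<and> (\<Sum>i<n. w i * (t (Suc i) - t i)) \<le> e)"
      using has_ts_integral_oscillation[OF C(3) v e] by blast
    obtain n t where P: "fine_partition T a b (min \<delta>1 \<delta>2) n t"
      using fine_partition_exists[OF T(1,3) _ T(2), of "min \<delta>1 \<delta>2"] d1(1) d2(1) T(4) by auto
    note t = fine_partitionD[OF P]
    have P1: "fine_partition T a b \<delta>1 n t" and P2: "fine_partition T a b \<delta>2 n t"
      using P by (auto intro: fine_partition_mono)
    obtain w1 where
      w1: "\<And>i x y. i < n \<Longrightarrow> x \<in> C1 (t i) (t (Suc i)) \<inter> T \<Longrightarrow> y \<in> C1 (t i) (t (Suc i)) \<inter> T \<Longrightarrow> \<bar>u x - u y\<bar> \<le> w1 i"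
        "\<And>i. i < n \<Longrightarrow> 0 \<le> w1 i" "(\<Sum>i<n. w1 i * (t (Suc i) - t i)) \<le> e"
      using d1(2)[rule_format, OF P1] by blast
    obtain w2 where
      w2: "\<And>i x y. i < n \<Longrightarrow> x \<in> C2 (t i) (t (Suc i)) \<inter> T \<Longrightarrow> y \<in> C2 (t i) (t (Suc i)) \<inter> T \<Longrightarrow> \<bar>v x - v y\<bar> \<le> w2 i"
        "\<And>i. i < n \<Longrightarrow> 0 \<le> w2 i" "(\<Sum>i<n. w2 i * (t (Suc i) - t i)) \<le> e"
      using d2(2)[rule_format, OF P2] by blast
    define w where "w i = \<epsilon>' + L * (w1 i + w2 i)" for i
    have "(\<Sum>i<n. w i * (t (Suc i) - t i)) =
        \<epsilon>' * (\<Sum>i<n. t (Suc i) - t i) + L * ((\<Sum>i<n. w1 i * (t (Suc i) - t i)) + (\<Sum>i<n. w2 i * (t (Suc i) - t i)))"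
      by (simp add: w_def sum_distrib_left sum.distrib[symmetric] algebra_simps)
    also have "\<dots> \<le> \<epsilon>' * (\<Sum>i<n. t (Suc i) - t i) + L * (e + e)"
      using w1(3) w2(3) L0 by (intro add_left_mono mult_left_mono add_mono)
    also have "(\<Sum>i<n. t (Suc i) - t i) = b - a"
      using t(1,2) by (simp add: sum_lessThan_telescope)
    also have "\<epsilon>' * (b - a) = \<epsilon> / 2" using T(4) by (simp add: \<epsilon>'_def field_simps)
    finally have "(\<Sum>i<n. w i * (t (Suc i) - t i)) \<le> \<epsilon> / 2 + L * (e + e)" .
    moreover have "L * (e + e) \<le> (L + 1) * (e + e)" using e by (intro mult_right_mono) auto
    moreover have "(L + 1) * (e + e) = \<epsilon> / 2" using L0 by (simp add: e_def divide_simps)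
    ultimately have sum: "(\<Sum>i<n. w i * (t (Suc i) - t i)) \<le> \<epsilon>" by linarith
    have osc: "\<bar>\<Phi> (u x, v x) - \<Phi> (u y, v y)\<bar> \<le> w i"
      if i: "i < n" and xy: "x \<in> T \<inter> {t i<..<t (Suc i)}" "y \<in> T \<inter> {t i<..<t (Suc i)}" for i x y
    proof -
      have sub: "{t i<..<t (Suc i)} \<subseteq> {a..b}"
        using fine_partition_cell_subset[OF half_open_Ico P i] by fastforce
      have mod: "\<bar>\<Phi> (u x, v x) - \<Phi> (u y, v y)\<bar> \<le> \<epsilon>' + L * (\<bar>u x - u y\<bar> + \<bar>v x - v y\<bar>)"
        using sub xy by (intro modulus K) auto
      \<comment> \<open>The open cell lies in the cells of both shapes \<open>C1\<close> and
        \<open>C2\<close>, so both oscillation bounds apply to it.\<close>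
      have u_osc: "\<bar>u x - u y\<bar> \<le> w1 i"
        by (rule w1(1)[OF i]) (use xy half_open_superset[OF C(2)] in blast)+
      have "\<bar>v x - v y\<bar> \<le> w2 i"
        by (rule w2(1)[OF i]) (use xy half_open_superset[OF C(3)] in blast)+
      then have "L * (\<bar>u x - u y\<bar> + \<bar>v x - v y\<bar>) \<le> L * (w1 i + w2 i)"
        using L0 u_osc by (intro mult_left_mono add_mono)
      with mod show ?thesis unfolding w_def by linarith
    qed
    have "0 \<le> w i" if "i < n" for i
      using w1(2)[OF that] w2(2)[OF that] \<epsilon>' L0 by (simp add: w_def)
    then show "\<exists>n t w. t 0 = a \<and> t n = b \<and> (\<forall>i<n. t i < t (Suc i) \<and> 0 \<le> w i) \<and>
      (\<forall>i<n. \<forall>x\<in>T \<inter> {t i<..<t (Suc i)}. \<forall>y\<in>T \<inter> {t i<..<t (Suc i)}.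
        \<bar>\<Phi> (u x, v x) - \<Phi> (u y, v y)\<bar> \<le> w i) \<and> (\<Sum>i<n. w i * (t (Suc i) - t i)) \<le> \<epsilon>"
      by (intro exI[of _ n] exI[of _ t] exI[of _ w] conjI allI impI ballI)
         (use sum t(1,2,4) in \<open>simp_all add: osc\<close>)
  qed
qed

section \<open>Linearity and monotonicity\<close>

lemma has_ts_integral_add:
  assumes "has_ts_integral C T f a b I" "has_ts_integral C T g a b J"
  shows "has_ts_integral C T (\<lambda>x. f x + g x) a b (I + J)"
  unfolding has_ts_integral_def
proof (intro allI impI)
  fix \<epsilon> :: real assume "\<epsilon> > 0"
  then have e: "\<epsilon> / 2 > 0" by simp
  obtain \<delta>1 where d1: "\<delta>1 > 0" "\<And>n t \<xi>. fine_partition T a b \<delta>1 n t \<Longrightarrow> (\<And>i. i < n \<Longrightarrow> \<xi> i \<in> C (t i) (t (Suc i)) \<inter> T) \<Longrightarrow>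
        \<bar>(\<Sum>i<n. f (\<xi> i) * (t (Suc i) - t i)) - I\<bar> < \<epsilon> / 2"
    by (rule has_ts_integralE[OF assms(1) e]) auto
  obtain \<delta>2 where d2: "\<delta>2 > 0" "\<And>n t \<xi>. fine_partition T a b \<delta>2 n t \<Longrightarrow> (\<And>i. i < n \<Longrightarrow> \<xi> i \<in> C (t i) (t (Suc i)) \<inter> T) \<Longrightarrow>
        \<bar>(\<Sum>i<n. g (\<xi> i) * (t (Suc i) - t i)) - J\<bar> < \<epsilon> / 2"
    by (rule has_ts_integralE[OF assms(2) e]) auto
  show "\<exists>\<delta>>0. \<forall>n t \<xi>. fine_partition T a b \<delta> n t \<and> (\<forall>i<n. \<xi> i \<in> C (t i) (t (Suc i)) \<inter> T) \<longrightarrow>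
        \<bar>(\<Sum>i<n. (f (\<xi> i) + g (\<xi> i)) * (t (Suc i) - t i)) - (I + J)\<bar> < \<epsilon>"
  proof (intro exI[of _ "min \<delta>1 \<delta>2"] conjI allI impI; (elim conjE)?)
    fix n t \<xi> assume "fine_partition T a b (min \<delta>1 \<delta>2) n t" "\<forall>i<n. \<xi> i \<in> C (t i) (t (Suc i)) \<inter> T"
    then show "\<bar>(\<Sum>i<n. (f (\<xi> i) + g (\<xi> i)) * (t (Suc i) - t i)) - (I + J)\<bar> < \<epsilon>"
      using d1(2)[of n t \<xi>] d2(2)[of n t \<xi>]
        fine_partition_mono[of T a b "min \<delta>1 \<delta>2" n t \<delta>1] fine_partition_mono[of T a b "min \<delta>1 \<delta>2" n t \<delta>2]
      unfolding distrib_right sum.distrib abs_less_iff by simp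
  qed (use d1 d2 in auto)
qed

lemma has_ts_integral_cmult:
  assumes "has_ts_integral C T f a b I"
  shows "has_ts_integral C T (\<lambda>x. c * f x) a b (c * I)"
  unfolding has_ts_integral_def
proof (intro allI impI)
  fix \<epsilon> :: real assume "\<epsilon> > 0"
  \<comment> \<open>The summand 1 admits \<open>c = 0\<close>.\<close>
  then have "\<epsilon> / (\<bar>c\<bar> + 1) > 0" by simp
  then obtain \<delta> where d: "\<delta> > 0" "\<And>n t \<xi>. fine_partition T a b \<delta> n t \<Longrightarrow> (\<And>i. i < n \<Longrightarrow> \<xi> i \<in> C (t i) (t (Suc i)) \<inter> T) \<Longrightarrow>
        \<bar>(\<Sum>i<n. f (\<xi> i) * (t (Suc i) - t i)) - I\<bar> < \<epsilon> / (\<bar>c\<bar> + 1)"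
    by (rule has_ts_integralE[OF assms]) auto
  show "\<exists>\<delta>>0. \<forall>n t \<xi>. fine_partition T a b \<delta> n t \<and> (\<forall>i<n. \<xi> i \<in> C (t i) (t (Suc i)) \<inter> T) \<longrightarrow>
        \<bar>(\<Sum>i<n. c * f (\<xi> i) * (t (Suc i) - t i)) - c * I\<bar> < \<epsilon>"
  proof (intro exI[of _ \<delta>] conjI d(1) allI impI)
    fix n t \<xi> assume P: "fine_partition T a b \<delta> n t \<and> (\<forall>i<n. \<xi> i \<in> C (t i) (t (Suc i)) \<inter> T)"
    let ?S = "\<Sum>i<n. f (\<xi> i) * (t (Suc i) - t i)"
    have "\<bar>(\<Sum>i<n. c * f (\<xi> i) * (t (Suc i) - t i)) - c * I\<bar> = \<bar>c\<bar> * \<bar>?S - I\<bar>"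
      by (simp add: abs_mult[symmetric] sum_distrib_left right_diff_distrib mult.assoc)
    also have "\<dots> \<le> (\<bar>c\<bar> + 1) * \<bar>?S - I\<bar>"
      by (intro mult_right_mono) auto
    also have "\<dots> < \<epsilon>"
      using d(2)[of n t \<xi>] P by (simp add: field_simps add_pos_nonneg)
    finally show "\<bar>(\<Sum>i<n. c * f (\<xi> i) * (t (Suc i) - t i)) - c * I\<bar> < \<epsilon>" .
  qed
qed

text \<open>Both sums are formed over one partition with the same tags and compare termwise;
  tolerance \<open>(I - J) / 2\<close> then excludes \<open>I > J\<close>. The existence of fine
  partitions keeps the defining condition of the integral from being vacuous.\<close>

lemma has_ts_integral_le:
  assumes C: "half_open C" and T: "closed T" "a \<in> T" "b \<in> T" "a \<le> b"
    and f: "has_ts_integral C T f a b I" and g: "has_ts_integral C T g a b J"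
    and le: "\<And>x. x \<in> T \<Longrightarrow> f x \<le> g x"
  shows "I \<le> J"
proof (rule ccontr)
  assume "\<not> I \<le> J"
  then have e: "(I - J) / 2 > 0" by simp
  obtain \<delta>1 where d1: "\<delta>1 > 0" "\<And>n t \<xi>. fine_partition T a b \<delta>1 n t \<Longrightarrow> (\<And>i. i < n \<Longrightarrow> \<xi> i \<in> C (t i) (t (Suc i)) \<inter> T) \<Longrightarrow>
        \<bar>(\<Sum>i<n. f (\<xi> i) * (t (Suc i) - t i)) - I\<bar> < (I - J) / 2"
    by (rule has_ts_integralE[OF f e]) auto
  obtain \<delta>2 where d2: "\<delta>2 > 0" "\<And>n t \<xi>. fine_partition T a b \<delta>2 n t \<Longrightarrow> (\<And>i. i < n \<Longrightarrow> \<xi> i \<in> C (t i) (t (Suc i)) \<inter> T) \<Longrightarrow>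
        \<bar>(\<Sum>i<n. g (\<xi> i) * (t (Suc i) - t i)) - J\<bar> < (I - J) / 2"
    by (rule has_ts_integralE[OF g e]) auto
  obtain n t where P: "fine_partition T a b (min \<delta>1 \<delta>2) n t"
    using fine_partition_exists[OF T(1,3) _ T(2,4), of "min \<delta>1 \<delta>2"] d1 d2 by auto
  obtain \<xi> where \<xi>: "\<And>i. i < n \<Longrightarrow> \<xi> i \<in> C (t i) (t (Suc i)) \<inter> T"
    using fine_partition_tags[OF C P] by metis
  have "(\<Sum>i<n. f (\<xi> i) * (t (Suc i) - t i)) \<le> (\<Sum>i<n. g (\<xi> i) * (t (Suc i) - t i))"
    using le \<xi> fine_partitionD(4)[OF P] by (intro sum_mono mult_right_mono) (auto simp: less_imp_le)
  moreover have "fine_partition T a b \<delta>1 n t" "fine_partition T a b \<delta>2 n t"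
    using P by (auto intro: fine_partition_mono)
  then have "\<bar>(\<Sum>i<n. f (\<xi> i) * (t (Suc i) - t i)) - I\<bar> < (I - J) / 2"
    "\<bar>(\<Sum>i<n. g (\<xi> i) * (t (Suc i) - t i)) - J\<bar> < (I - J) / 2"
    using d1(2)[of n t \<xi>] d2(2)[of n t \<xi>] \<xi> by auto
  ultimately show False unfolding abs_less_iff by (simp add: field_simps)
qed

lemma has_ts_integral_unique:
  assumes "half_open C" "closed T" "a \<in> T" "b \<in> T" "a \<le> b"
    and "has_ts_integral C T f a b I" "has_ts_integral C T f a b J"
  shows "I = J"
  using has_ts_integral_le[OF assms(1-7) order_refl] has_ts_integral_le[OF assms(1-5,7,6) order_refl]
  by (rule order_antisym)

text \<open>Tags lie in \<open>T\<close>, so equality there suffices. It is used with identities for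
  \<open>gamma1\<close> and \<open>gamma2\<close> that are established on \<open>T\<close>.\<close>

lemma has_ts_integral_cong:
  assumes "has_ts_integral C T f a b I" and eq: "\<And>x. x \<in> T \<Longrightarrow> f x = g x"
  shows "has_ts_integral C T g a b I"
  unfolding has_ts_integral_def
proof (intro allI impI)
  fix \<epsilon> :: real assume e: "\<epsilon> > 0"
  obtain \<delta> where d: "\<delta> > 0" "\<And>n t \<xi>. fine_partition T a b \<delta> n t \<Longrightarrow> (\<And>i. i < n \<Longrightarrow> \<xi> i \<in> C (t i) (t (Suc i)) \<inter> T) \<Longrightarrow>
        \<bar>(\<Sum>i<n. f (\<xi> i) * (t (Suc i) - t i)) - I\<bar> < \<epsilon>"
    by (rule has_ts_integralE[OF assms(1) e]) auto
  show "\<exists>\<delta>>0. \<forall>n t \<xi>. fine_partition T a b \<delta> n t \<and> (\<forall>i<n. \<xi> i \<in> C (t i) (t (Suc i)) \<inter> T) \<longrightarrow>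
        \<bar>(\<Sum>i<n. g (\<xi> i) * (t (Suc i) - t i)) - I\<bar> < \<epsilon>"
  proof (intro exI[of _ \<delta>] conjI d(1) allI impI)
    fix n t \<xi> assume P: "fine_partition T a b \<delta> n t \<and> (\<forall>i<n. \<xi> i \<in> C (t i) (t (Suc i)) \<inter> T)"
    then have "(\<Sum>i<n. g (\<xi> i) * (t (Suc i) - t i)) = (\<Sum>i<n. f (\<xi> i) * (t (Suc i) - t i))"
      using eq by (intro sum.cong) auto
    then show "\<bar>(\<Sum>i<n. g (\<xi> i) * (t (Suc i) - t i)) - I\<bar> < \<epsilon>"
      using d(2)[of n t \<xi>] P by simp
  qed
qed

section \<open>The diamond integral\<close>

text \<open>As \<open>\<rho> \<le> t \<le> \<sigma>\<close>, two cases arise. If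
  \<open>\<rho> = \<sigma>\<close>, both quotients equal \<open>1 / 2\<close> for all
  \<open>s \<noteq> t\<close>. Otherwise the denominator tends to
  \<open>\<sigma> - \<rho> > 0\<close>, and the weights are
  \<open>(\<sigma> - t) / (\<sigma> - \<rho>)\<close> and
  \<open>(t - \<rho>) / (\<sigma> - \<rho>)\<close>.\<close>

lemma gamma_props:
  assumes "closed T" "t \<in> T"
  shows "gamma1 T t + gamma2 T t = 1" "0 \<le> gamma1 T t" "0 \<le> gamma2 T t"
proof -
  define \<sigma> \<rho> where "\<sigma> = fwd_jump T t" and "\<rho> = bwd_jump T t"
  have \<sigma>: "t \<le> \<sigma>"
  proof (cases "{s \<in> T. s > t} = {}")
    case True
    \<comment> \<open>Here \<open>t\<close> is the maximum of \<open>T\<close>, and the convention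
      for the empty set gives \<open>\<sigma> = t\<close>.\<close>
    then have "Sup T = t" using assms by (intro cSup_eq_maximum) (auto simp: not_less[symmetric])
    then show ?thesis using True by (simp add: \<sigma>_def fwd_jump_def)
  next
    case False
    then have "t \<le> Inf {s \<in> T. s > t}" by (intro cInf_greatest) auto
    then show ?thesis unfolding \<sigma>_def fwd_jump_def if_not_P[OF False] .
  qed
  have \<rho>: "\<rho> \<le> t"
  proof (cases "{s \<in> T. s < t} = {}")
    case True
    then have "Inf T = t" using assms by (intro cInf_eq_minimum) (auto simp: not_less[symmetric])
    then show ?thesis using True by (simp add: \<rho>_def bwd_jump_def)
  next
    case False
    then have "Sup {s \<in> T. s < t} \<le> t" by (intro cSup_least) auto
    then show ?thesis unfolding \<rho>_def bwd_jump_def if_not_P[OF False] .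
  qed
  have "gamma1 T t + gamma2 T t = 1 \<and> 0 \<le> gamma1 T t \<and> 0 \<le> gamma2 T t"
  proof (cases "\<rho> = \<sigma>")
    case True
    then have eq: "\<sigma> = t" "\<rho> = t" using \<sigma> \<rho> by auto
    have ev: "\<forall>\<^sub>F s in at t. s \<noteq> t" by (simp add: eventually_at_filter)
    have "((\<lambda>s. (t - s) / (t + 2 * t - 2 * s - t)) \<longlongrightarrow> 1 / 2) (at t)"
      by (rule tendsto_eventually, rule eventually_mono[OF ev]) (auto simp: divide_simps)
    then have g1: "gamma1 T t = 1 / 2"
      unfolding gamma1_def \<sigma>_def[symmetric] \<rho>_def[symmetric] eq by (intro tendsto_Lim) auto
    have "((\<lambda>s. (2 * t - s - t) / (t + 2 * t - 2 * s - t)) \<longlongrightarrow> 1 / 2) (at t)"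
      by (rule tendsto_eventually, rule eventually_mono[OF ev]) (auto simp: divide_simps)
    then have g2: "gamma2 T t = 1 / 2"
      unfolding gamma2_def \<sigma>_def[symmetric] \<rho>_def[symmetric] eq by (intro tendsto_Lim) auto
    show ?thesis using g1 g2 by simp
  next
    case False
    then have d: "\<sigma> - \<rho> > 0" using \<sigma> \<rho> by auto
    have "((\<lambda>s. (\<sigma> - s) / (\<sigma> + 2 * t - 2 * s - \<rho>)) \<longlongrightarrow> (\<sigma> - t) / (\<sigma> + 2 * t - 2 * t - \<rho>)) (at t)"
      using d by (intro tendsto_intros) auto
    then have g1: "gamma1 T t = (\<sigma> - t) / (\<sigma> - \<rho>)"
      unfolding gamma1_def \<sigma>_def[symmetric] \<rho>_def[symmetric] by (intro tendsto_Lim) auto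
    have "((\<lambda>s. (2 * t - s - \<rho>) / (\<sigma> + 2 * t - 2 * s - \<rho>)) \<longlongrightarrow> (2 * t - t - \<rho>) / (\<sigma> + 2 * t - 2 * t - \<rho>)) (at t)"
      using d by (intro tendsto_intros) auto
    then have g2: "gamma2 T t = (t - \<rho>) / (\<sigma> - \<rho>)"
      unfolding gamma2_def \<sigma>_def[symmetric] \<rho>_def[symmetric] by (intro tendsto_Lim) auto
    show ?thesis using g1 g2 d \<sigma> \<rho> by (simp add: add_divide_distrib[symmetric])
  qed
  then show "gamma1 T t + gamma2 T t = 1" "0 \<le> gamma1 T t" "0 \<le> gamma2 T t" by auto
qed

text \<open>Carries integrability and value together, so that \<open>THE\<close> has to be resolved
  only once, in \<open>diamond_integral_eq\<close>.\<close>

definition has_diamond_integral ::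
  "real set \<Rightarrow> (real \<Rightarrow> real) \<Rightarrow> real \<Rightarrow> real \<Rightarrow> real \<Rightarrow> bool" where
  "has_diamond_integral T f a b I \<longleftrightarrow> (\<exists>J K. I = J + K \<and>
     has_ts_integral atLeastLessThan T (\<lambda>t. gamma1 T t * f t) a b J \<and>
     has_ts_integral greaterThanAtMost T (\<lambda>t. gamma2 T t * f t) a b K)"

lemma diamond_integrable_iff: "diamond_integrable T f a b \<longleftrightarrow> (\<exists>I. has_diamond_integral T f a b I)"
  by (auto simp: diamond_integrable_def has_diamond_integral_def delta_integrable_def
      nabla_integrable_def has_delta_integral_iff has_nabla_integral_iff)

lemma diamond_integral_eq:
  assumes "closed T" "a \<in> T" "b \<in> T" "a \<le> b" "has_diamond_integral T f a b I"
  shows "diamond_integral T f a b = I"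
proof -
  obtain J K where JK: "I = J + K"
    "has_ts_integral atLeastLessThan T (\<lambda>t. gamma1 T t * f t) a b J"
    "has_ts_integral greaterThanAtMost T (\<lambda>t. gamma2 T t * f t) a b K"
    using assms(5) unfolding has_diamond_integral_def by blast
  have "delta_integral T (\<lambda>t. gamma1 T t * f t) a b = J"
    unfolding delta_integral_def has_delta_integral_iff
    using has_ts_integral_unique[OF half_open_Ico assms(1-4)] JK by blast
  moreover have "nabla_integral T (\<lambda>t. gamma2 T t * f t) a b = K"
    unfolding nabla_integral_def has_nabla_integral_iff
    using has_ts_integral_unique[OF half_open_Ioc assms(1-4)] JK by blast
  ultimately show ?thesis using JK by (simp add: diamond_integral_def)
qed

lemma has_diamond_integral_add:
  assumes "has_diamond_integral T f a b I" "has_diamond_integral T g a b J"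
  shows "has_diamond_integral T (\<lambda>t. f t + g t) a b (I + J)"
proof -
  obtain I1 I2 J1 J2 where *: "I = I1 + I2" "J = J1 + J2"
    "has_ts_integral atLeastLessThan T (\<lambda>t. gamma1 T t * f t) a b I1"
    "has_ts_integral greaterThanAtMost T (\<lambda>t. gamma2 T t * f t) a b I2"
    "has_ts_integral atLeastLessThan T (\<lambda>t. gamma1 T t * g t) a b J1"
    "has_ts_integral greaterThanAtMost T (\<lambda>t. gamma2 T t * g t) a b J2"
    using assms unfolding has_diamond_integral_def by blast
  show ?thesis
    unfolding has_diamond_integral_def distrib_left
    using has_ts_integral_add[OF *(3,5)] has_ts_integral_add[OF *(4,6)] *(1,2)
    by (intro exI[of _ "I1 + J1"] exI[of _ "I2 + J2"]) simp
qed

lemma has_diamond_integral_cmult: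
  assumes "has_diamond_integral T f a b I"
  shows "has_diamond_integral T (\<lambda>t. c * f t) a b (c * I)"
proof -
  obtain I1 I2 where *: "I = I1 + I2"
    "has_ts_integral atLeastLessThan T (\<lambda>t. gamma1 T t * f t) a b I1"
    "has_ts_integral greaterThanAtMost T (\<lambda>t. gamma2 T t * f t) a b I2"
    using assms unfolding has_diamond_integral_def by blast
  show ?thesis
    unfolding has_diamond_integral_def mult.left_commute[of _ c]
    using has_ts_integral_cmult[OF *(2), of c] has_ts_integral_cmult[OF *(3), of c] *(1)
    by (intro exI[of _ "c * I1"] exI[of _ "c * I2"]) (simp add: distrib_left)
qed

text \<open>Nonnegativity of both weights preserves the pointwise inequality in the delta part and
  in the nabla part.\<close>

lemma has_diamond_integral_le:
  assumes T: "closed T" "a \<in> T" "b \<in> T" "a \<le> b"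
    and f: "has_diamond_integral T f a b I" and g: "has_diamond_integral T g a b J"
    and le: "\<And>x. x \<in> T \<Longrightarrow> f x \<le> g x"
  shows "I \<le> J"
proof -
  obtain I1 I2 J1 J2 where *: "I = I1 + I2" "J = J1 + J2"
    "has_ts_integral atLeastLessThan T (\<lambda>t. gamma1 T t * f t) a b I1"
    "has_ts_integral greaterThanAtMost T (\<lambda>t. gamma2 T t * f t) a b I2"
    "has_ts_integral atLeastLessThan T (\<lambda>t. gamma1 T t * g t) a b J1"
    "has_ts_integral greaterThanAtMost T (\<lambda>t. gamma2 T t * g t) a b J2"
    using f g unfolding has_diamond_integral_def by blast
  have "I1 \<le> J1"
    by (rule has_ts_integral_le[OF half_open_Ico T *(3,5)])
       (use le gamma_props[OF T(1)] in \<open>auto intro: mult_left_mono\<close>)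
  moreover have "I2 \<le> J2"
    by (rule has_ts_integral_le[OF half_open_Ioc T *(4,6)])
       (use le gamma_props[OF T(1)] in \<open>auto intro: mult_left_mono\<close>)
  ultimately show ?thesis using * by simp
qed

lemma has_diamond_integral_nonneg:
  assumes T: "closed T" "a \<in> T" "b \<in> T" "a \<le> b"
    and f: "has_diamond_integral T f a b I" and nn: "\<And>x. x \<in> T \<Longrightarrow> 0 \<le> f x"
  shows "0 \<le> I"
  \<comment> \<open>The zero function enters as \<open>0 * f\<close>, whose integral is 0 by
    linearity.\<close>
  using has_diamond_integral_le[OF T has_diamond_integral_cmult[OF f, of 0] f] nn by simp

lemma diamond_integrable_abs_powr:
  assumes T: "closed T" "a \<in> T" "b \<in> T" "a < b" and p: "p > 1"
    and f: "diamond_integrable T f a b"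
  shows "diamond_integrable T (\<lambda>t. \<bar>f t\<bar> powr p) a b"
proof -
  obtain J K where JK:
    "has_ts_integral atLeastLessThan T (\<lambda>t. gamma1 T t * f t) a b J"
    "has_ts_integral greaterThanAtMost T (\<lambda>t. gamma2 T t * f t) a b K"
    using f by (auto simp: diamond_integrable_iff has_diamond_integral_def)
  have f_eq: "gamma1 T t * f t + gamma2 T t * f t = f t" if "t \<in> T" for t
    using gamma_props(1)[OF T(1) that] by (simp add: distrib_right[symmetric])
  (* Near a point where gamma1 jumps only its product with f is controlled, so gamma1 |f|^p has to be
     written as a continuous function of gamma1 f and gamma2 f. *)
  have powr_eq: "\<bar>x\<bar> powr p = \<bar>x\<bar> * \<bar>x\<bar> powr (p - 1)" for x :: real
    by (cases "x = 0") (simp_all add: powr_diff)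
  \<comment> \<open>The exponent \<open>p - 1\<close> is positive, so the power is continuous also
    where its base vanishes.\<close>
  have cont: "continuous_on UNIV (\<lambda>z::real \<times> real. \<bar>fst z\<bar> * \<bar>fst z + snd z\<bar> powr (p - 1))"
    "continuous_on UNIV (\<lambda>z::real \<times> real. \<bar>snd z\<bar> * \<bar>fst z + snd z\<bar> powr (p - 1))"
    using p by (auto intro!: continuous_intros continuous_on_powr')
  obtain J' where "has_ts_integral atLeastLessThan T (\<lambda>t. \<bar>gamma1 T t * f t\<bar> *
      \<bar>gamma1 T t * f t + gamma2 T t * f t\<bar> powr (p - 1)) a b J'"
    using has_ts_integral_compose2[OF half_open_Ico half_open_Ico half_open_Ioc T JK cont(1)] by auto
  then have J': "has_ts_integral atLeastLessThan T (\<lambda>t. gamma1 T t * \<bar>f t\<bar> powr p) a b J'"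
    by (rule has_ts_integral_cong)
       (simp add: f_eq powr_eq[of "f _"] abs_mult gamma_props(2)[OF T(1)])
  obtain K' where "has_ts_integral greaterThanAtMost T (\<lambda>t. \<bar>gamma2 T t * f t\<bar> *
      \<bar>gamma1 T t * f t + gamma2 T t * f t\<bar> powr (p - 1)) a b K'"
    using has_ts_integral_compose2[OF half_open_Ioc half_open_Ico half_open_Ioc T JK cont(2)] by auto
  then have K': "has_ts_integral greaterThanAtMost T (\<lambda>t. gamma2 T t * \<bar>f t\<bar> powr p) a b K'"
    by (rule has_ts_integral_cong)
       (simp add: f_eq powr_eq[of "f _"] abs_mult gamma_props(3)[OF T(1)])
  show ?thesis using J' K' by (auto simp: diamond_integrable_iff has_diamond_integral_def)
qed

section \<open>Minkowski's inequality\<close>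

text \<open>Convexity of the \<open>p\<close>-th power, applied to \<open>x + y\<close> written as
  the combination of \<open>x / l\<close> and \<open>y / (1 - l)\<close> with weights
  \<open>l\<close> and \<open>1 - l\<close>.\<close>

lemma add_powr_le_weighted:
  fixes x y p l :: real
  assumes "p > 1" "0 < l" "l < 1" "0 \<le> x" "0 \<le> y"
  shows "(x + y) powr p \<le> l powr (1 - p) * x powr p + (1 - l) powr (1 - p) * y powr p"
proof -
  have *: "(u + v) powr p \<le> m powr (1 - p) * u powr p + (1 - m) powr (1 - p) * v powr p"
    if m: "0 < m" "m < 1" and uv: "u = 0" "0 \<le> v" for u v m :: real
  proof -
    \<comment> \<open>A base below 1 is raised to a negative exponent; this settles the case of one
      vanishing summand.\<close>
    have "1 \<le> (1 - m) powr (1 - p)"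
      using m assms(1) by (simp add: powr_def mult_nonpos_nonpos)
    then have "1 * v powr p \<le> (1 - m) powr (1 - p) * v powr p"
      by (intro mult_right_mono) auto
    then show ?thesis using uv assms(1) by simp
  qed
  show ?thesis
  proof (cases "x > 0 \<and> y > 0")
    case True
    have "(l * (x / l) + (1 - l) * (y / (1 - l))) powr p \<le> l * (x / l) powr p + (1 - l) * (y / (1 - l)) powr p"
      using convex_onD[OF powr_convex[of p], of "1 - l" "x / l" "y / (1 - l)"] True assms by simp
    also have "l * (x / l) powr p = l powr (1 - p) * x powr p"
      using assms by (simp add: powr_divide powr_diff)
    also have "(1 - l) * (y / (1 - l)) powr p = (1 - l) powr (1 - p) * y powr p"
      using assms by (simp add: powr_divide powr_diff)
    finally show ?thesis using assms by simp
  next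
    case False
    then consider "x = 0" | "y = 0" using assms by force
    then show ?thesis
      using *[of l x y] *[of "1 - l" y x] assms by cases (auto simp: add.commute)
  qed
qed

text \<open>With \<open>A\<close> and \<open>B\<close> slightly above the two roots and
  \<open>l = A / (A + B)\<close>, the bound becomes at most
  \<open>A * (A + B) powr (p - 1) + B * (A + B) powr (p - 1)\<close>, which is
  \<open>(A + B) powr p\<close>. Taking roots leaves \<open>A + B\<close>.\<close>

lemma powr_minkowski_of_weighted:
  fixes F G H p :: real
  assumes p: "p > 1" and nn: "0 \<le> F" "0 \<le> G" "0 \<le> H"
    and le: "\<And>l. 0 < l \<Longrightarrow> l < 1 \<Longrightarrow> H \<le> l powr (1 - p) * F + (1 - l) powr (1 - p) * G"
  shows "H powr (1 / p) \<le> F powr (1 / p) + G powr (1 / p)"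
proof (rule field_le_epsilon)
  fix e :: real assume e: "e > 0"
  (* The shift by e / 2 covers the case of vanishing F or G. *)
  define A B where "A = F powr (1 / p) + e / 2" and "B = G powr (1 / p) + e / 2"
  have pos: "A > 0" "B > 0" using e by (auto simp: A_def B_def add_nonneg_pos)
  have "(F powr (1 / p)) powr p \<le> A powr p" "(G powr (1 / p)) powr p \<le> B powr p"
    using p e by (auto simp: A_def B_def intro!: powr_mono2)
  then have FG: "F \<le> A powr p" "G \<le> B powr p"
    using p nn by (simp_all add: powr_powr)
  have key: "(X / (A + B)) powr (1 - p) * X powr p = X * (A + B) powr (p - 1)" if "X > 0" for X
    using that pos by (simp add: powr_divide powr_diff)
  have "1 - A / (A + B) = B / (A + B)" using pos by (simp add: field_simps)
  then have "H \<le> (A / (A + B)) powr (1 - p) * F + (B / (A + B)) powr (1 - p) * G"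
    using le[of "A / (A + B)"] pos by simp
  also have "\<dots> \<le> (A / (A + B)) powr (1 - p) * A powr p + (B / (A + B)) powr (1 - p) * B powr p"
    using FG by (intro add_mono mult_left_mono) auto
  also have "\<dots> = (A + B) * (A + B) powr (p - 1)"
    using pos by (simp only: key distrib_right)
  also have "\<dots> = (A + B) powr p" using pos by (simp add: powr_diff)
  finally have "H powr (1 / p) \<le> ((A + B) powr p) powr (1 / p)"
    using nn p by (intro powr_mono2) auto
  also have "\<dots> = A + B" using pos p by (simp add: powr_powr)
  finally show "H powr (1 / p) \<le> F powr (1 / p) + G powr (1 / p) + e"
    by (simp add: A_def B_def)
qed

text \<open>Integrability of the three powers belongs to the conclusion, since only then do the
  integrals in the inequality have their intended meaning.\<close>

theorem theorem8p3p8: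
  fixes T :: "real set" and a b p :: real and f g :: "real \<Rightarrow> real"
  assumes "time_scale T" and "a \<in> T" and "b \<in> T" and "a < b"
    and "diamond_integrable T f a b" and "diamond_integrable T g a b"
    and "p > 1"
  shows "diamond_integrable T (\<lambda>t. \<bar>f t + g t\<bar> powr p) a b \<and>
         diamond_integrable T (\<lambda>t. \<bar>f t\<bar> powr p) a b \<and>
         diamond_integrable T (\<lambda>t. \<bar>g t\<bar> powr p) a b \<and>
         (diamond_integral T (\<lambda>t. \<bar>f t + g t\<bar> powr p) a b) powr (1 / p)
           \<le> (diamond_integral T (\<lambda>t. \<bar>f t\<bar> powr p) a b) powr (1 / p)
             + (diamond_integral T (\<lambda>t. \<bar>g t\<bar> powr p) a b) powr (1 / p)"
proof -
  have T: "closed T" "a \<in> T" "b \<in> T" "a < b" "a \<le> b"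
    using assms(1-4) by (auto simp: time_scale_def)
  note int = diamond_integrable_abs_powr[OF T(1-4) \<open>p > 1\<close>]
  have "diamond_integrable T (\<lambda>t. f t + g t) a b"
    using assms(5,6) has_diamond_integral_add unfolding diamond_integrable_iff by blast
  note integrable = int[OF this] int[OF assms(5)] int[OF assms(6)]
  then obtain H F G where H: "has_diamond_integral T (\<lambda>t. \<bar>f t + g t\<bar> powr p) a b H"
    and F: "has_diamond_integral T (\<lambda>t. \<bar>f t\<bar> powr p) a b F"
    and G: "has_diamond_integral T (\<lambda>t. \<bar>g t\<bar> powr p) a b G"
    unfolding diamond_integrable_iff by blast
  \<comment> \<open>For fixed \<open>l\<close> the weights are constants in \<open>t\<close>, so the
    pointwise convexity bound can be integrated.\<close>
  have "H \<le> l powr (1 - p) * F + (1 - l) powr (1 - p) * G" if l: "0 < l" "l < 1" for l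
  proof (rule has_diamond_integral_le[OF T(1-3,5) H
        has_diamond_integral_add[OF has_diamond_integral_cmult[OF F] has_diamond_integral_cmult[OF G]]])
    fix t
    have "\<bar>f t + g t\<bar> powr p \<le> (\<bar>f t\<bar> + \<bar>g t\<bar>) powr p"
      using \<open>p > 1\<close> by (intro powr_mono2) auto
    also have "\<dots> \<le> l powr (1 - p) * \<bar>f t\<bar> powr p + (1 - l) powr (1 - p) * \<bar>g t\<bar> powr p"
      using add_powr_le_weighted[OF \<open>p > 1\<close> l] by simp
    finally show "\<bar>f t + g t\<bar> powr p \<le> l powr (1 - p) * \<bar>f t\<bar> powr p + (1 - l) powr (1 - p) * \<bar>g t\<bar> powr p" .
  qed
  moreover have "0 \<le> F" "0 \<le> G" "0 \<le> H"
    using F G H by (auto intro: has_diamond_integral_nonneg[OF T(1-3,5)])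
  ultimately have "H powr (1 / p) \<le> F powr (1 / p) + G powr (1 / p)"
    using powr_minkowski_of_weighted[OF \<open>p > 1\<close>] by blast
  then show ?thesis
    using integrable diamond_integral_eq[OF T(1-3,5)] F G H by simp
qed

end
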